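(* Let $R$ be a commutative ring, let $\mathfrak{a}\subseteq R$ be an ideal of finite type (i.e. finitely generated), and let $M$ be an $R$-module. Then: (1) if every associated prime of $M/\Gamma_{\mathfrak{a}}(M)$ (i.e. every element of $\mathrm{Ass}_R(M/\Gamma_{\mathfrak{a}}(M))$) is an ideal of finite type, then $M$ is $\mathfrak{a}$-fair; (2) if every weakly associated prime of $M/\Gamma_{\mathfrak{a}}(M)$ (i.e. every element of $\mathrm{Ass}^{\rm f}_R(M/\Gamma_{\mathfrak{a}}(M))$) is an ideal of finite type, then $M$ is weakly $\mathfrak{a}$-fair.
   Context: Rings are commutative with unit (not assumed noetherian). $\mathrm{Var}(\mathfrak{a})$ is the set of prime ideals of $R$ containing $\mathfrak{a}$, and $\Gamma_{\mathfrak{a}}(M)=\{x\in M\mid\exists n\in\mathbb{N}:\mathfrak{a}^nx=0\}$. For $x\in M$, $(0:_Rx)=\{r\in R\mid rx=0\}$. The assassin $\mathrm{Ass}_R(M)$ is the set of prime ideals of $R$ of the form $(0:_Rx)$ for some $x\in M$. The weak assassin $\mathrm{Ass}^{\rm f}_R(M)$ is the set of prime ideals $\mathfrak{p}$ of $R$ such that there exists $x\in M$ for which $\mathfrak{p}$ is minimal (with respect to inclusion) among the prime ideals containing $(0:_Rx)$. The $R$-module $M$ is called $\mathfrak{a}$-fair if $\mathrm{Ass}_R(M/\Gamma_{\mathfrak{a}}(M))=\mathrm{Ass}_R(M)\setminus\mathrm{Var}(\mathfrak{a})$, and weakly $\mathfrak{a}$-fair if $\mathrm{Ass}^{\rm f}_R(M/\Gamma_{\mathfrak{a}}(M))=\mathrm{Ass}^{\rm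 f}_R(M)\setminus\mathrm{Var}(\mathfrak{a})$. *)

theory Defs
  imports "HOL-Algebra.Module" "HOL-Algebra.QuotRing" "HOL-Algebra.Ideal_Product"
begin

definition finite_type_ideal :: "('a, 'm) ring_scheme \<Rightarrow> 'a set \<Rightarrow> bool" where
  "finite_type_ideal R I \<longleftrightarrow>
     ideal I R \<and> (\<exists>S \<subseteq> carrier R. finite S \<and> I = Idl\<^bsub>R\<^esub> S)"

definition ideal_var :: "('a, 'm) ring_scheme \<Rightarrow> 'a set \<Rightarrow> 'a set set" where
  "ideal_var R I = {p. primeideal p R \<and> I \<subseteq> p}"

definition elem_ann ::
    "('a, 'm) ring_scheme \<Rightarrow> ('a, 'b, 'n) module_scheme \<Rightarrow> 'b \<Rightarrow> 'a set" where
  "elem_ann R M x = {r \<in> carrier R. r \<odot>\<^bsub>M\<^esub> x = \<zero>\<^bsub>M\<^esub>}"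

text \<open>Powers are taken in the semiring \<^const>\<open>ideals_set\<close> of ideals, so the zeroth power
  is the whole ring.\<close>

definition torsion_part ::
    "('a, 'm) ring_scheme \<Rightarrow> 'a set \<Rightarrow> ('a, 'b, 'n) module_scheme \<Rightarrow> 'b set" where
  "torsion_part R I M =
     {x \<in> carrier M. \<exists>n::nat. \<forall>r \<in> I [^]\<^bsub>ideals_set R\<^esub> n. r \<odot>\<^bsub>M\<^esub> x = \<zero>\<^bsub>M\<^esub>}"

text \<open>The record type of modules extends that of rings; the locale \<^locale>\<open>module\<close> puts no condition
  on the fields \<^const>\<open>mult\<close> and \<^const>\<open>one\<close>, so they are left unspecified.  The union in the
  scalar multiplication is over equal cosets when \<open>N\<close> is a submodule, as in
  \<^const>\<open>rcoset_mult\<close>.\<close>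

definition quot_module ::
    "('a, 'b, 'n) module_scheme \<Rightarrow> 'b set \<Rightarrow> ('a, 'b set) module" where
  "quot_module M N =
     \<lparr>carrier = a_rcosets\<^bsub>M\<^esub> N, mult = undefined, one = undefined,
      zero = N, add = set_add M,
      smult = (\<lambda>r X. \<Union>x\<in>X. N +>\<^bsub>M\<^esub> (r \<odot>\<^bsub>M\<^esub> x))\<rparr>"

definition Ass :: "('a, 'm) ring_scheme \<Rightarrow> ('a, 'b, 'n) module_scheme \<Rightarrow> 'a set set" where
  "Ass R M = {p. primeideal p R \<and> (\<exists>x \<in> carrier M. p = elem_ann R M x)}"

definition minimal_prime_over :: "('a, 'm) ring_scheme \<Rightarrow> 'a set \<Rightarrow> 'a set \<Rightarrow> bool" where
  "minimal_prime_over R I p \<longleftrightarrow>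
     p \<in> ideal_var R I \<and> (\<forall>q \<in> ideal_var R I. q \<subseteq> p \<longrightarrow> q = p)"

definition weak_Ass :: "('a, 'm) ring_scheme \<Rightarrow> ('a, 'b, 'n) module_scheme \<Rightarrow> 'a set set" where
  "weak_Ass R M =
     {p. primeideal p R \<and> (\<exists>x \<in> carrier M. minimal_prime_over R (elem_ann R M x) p)}"

definition fair_module :: "('a, 'm) ring_scheme \<Rightarrow> 'a set \<Rightarrow> ('a, 'b, 'n) module_scheme \<Rightarrow> bool" where
  "fair_module R I M \<longleftrightarrow> Ass R (quot_module M (torsion_part R I M)) = Ass R M - ideal_var R I"

definition weakly_fair_module ::
    "('a, 'm) ring_scheme \<Rightarrow> 'a set \<Rightarrow> ('a, 'b, 'n) module_scheme \<Rightarrow> bool" where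
  "weakly_fair_module R I M \<longleftrightarrow>
     weak_Ass R (quot_module M (torsion_part R I M)) = weak_Ass R M - ideal_var R I"

lemma (in module) quot_module_smult_coset:
  assumes N: "submodule N R M" and r: "r \<in> carrier R" and x: "x \<in> carrier M"
  shows "r \<odot>\<^bsub>quot_module M N\<^esub> (N +>\<^bsub>M\<^esub> x) = N +>\<^bsub>M\<^esub> (r \<odot>\<^bsub>M\<^esub> x)"
proof -
  have sg: "subgroup N (add_monoid M)" using N by (simp add: submodule_def)
  have as: "abelian_subgroup N M"
    by (rule abelian_subgroupI3[OF additive_subgroup.intro[OF sg] M.abelian_group_axioms])
  have NM: "N \<subseteq> carrier M" and N0: "\<zero>\<^bsub>M\<^esub> \<in> N"
    using submoduleE[OF N] sg subgroup.one_closed by force+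
  have *: "N +>\<^bsub>M\<^esub> (r \<odot>\<^bsub>M\<^esub> y) = N +>\<^bsub>M\<^esub> (r \<odot>\<^bsub>M\<^esub> x)" if y: "y \<in> N +>\<^bsub>M\<^esub> x" for y
  proof -
    obtain h where h: "h \<in> N" "y = h \<oplus>\<^bsub>M\<^esub> x" using y by (auto simp: a_r_coset_def')
    have "r \<odot>\<^bsub>M\<^esub> h \<in> N" by (rule submoduleE(4)[OF N r h(1)])
    moreover have "r \<odot>\<^bsub>M\<^esub> y = r \<odot>\<^bsub>M\<^esub> h \<oplus>\<^bsub>M\<^esub> r \<odot>\<^bsub>M\<^esub> x"
      using h NM r x by (auto simp: smult_r_distr)
    ultimately have "r \<odot>\<^bsub>M\<^esub> y \<in> N +>\<^bsub>M\<^esub> (r \<odot>\<^bsub>M\<^esub> x)"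
      by (auto simp: a_r_coset_def')
    thus ?thesis using abelian_subgroup.a_repr_independence'[OF as] r x by simp
  qed
  have "x \<in> N +>\<^bsub>M\<^esub> x" using N0 x by (force simp: a_r_coset_def')
  hence "(\<Union>y \<in> N +>\<^bsub>M\<^esub> x. N +>\<^bsub>M\<^esub> (r \<odot>\<^bsub>M\<^esub> y)) = N +>\<^bsub>M\<^esub> (r \<odot>\<^bsub>M\<^esub> x)"
    using * by blast
  thus ?thesis by (simp add: quot_module_def)
qed

lemma (in module) quot_module_is_module:
  assumes N: "submodule N R M"
  shows "module R (quot_module M N)"
proof -
  let ?Q = "quot_module M N"
  have sg: "subgroup N (add_monoid M)" using N by (simp add: submodule_def)
  have as: "abelian_subgroup N M"
    by (rule abelian_subgroupI3[OF additive_subgroup.intro[OF sg] M.abelian_group_axioms])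
  have addc: "(N +>\<^bsub>M\<^esub> x) \<oplus>\<^bsub>?Q\<^esub> (N +>\<^bsub>M\<^esub> y) = N +>\<^bsub>M\<^esub> (x \<oplus>\<^bsub>M\<^esub> y)"
    if "x \<in> carrier M" "y \<in> carrier M" for x y
    using abelian_subgroup.a_rcos_sum[OF as that] by (simp add: quot_module_def)
  have carr: "X \<in> carrier ?Q \<longleftrightarrow> (\<exists>x\<in>carrier M. X = N +>\<^bsub>M\<^esub> x)" for X
    by (auto simp: quot_module_def A_RCOSETS_def')
  have zero: "\<zero>\<^bsub>?Q\<^esub> = N +>\<^bsub>M\<^esub> \<zero>\<^bsub>M\<^esub>"
    using M.a_coset_add_zero submoduleE(1)[OF N] by (simp add: quot_module_def)
  show ?thesis
  proof (rule moduleI)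
    show "cring R" by (rule R.is_cring)
    show "abelian_group ?Q"
    proof (rule abelian_groupI)
      fix X assume "X \<in> carrier ?Q"
      then obtain x where x: "x \<in> carrier M" "X = N +>\<^bsub>M\<^esub> x" using carr by blast
      have "(N +>\<^bsub>M\<^esub> (\<ominus>\<^bsub>M\<^esub> x)) \<oplus>\<^bsub>?Q\<^esub> X = \<zero>\<^bsub>?Q\<^esub>"
        using x by (simp add: addc zero M.l_neg)
      thus "\<exists>Y\<in>carrier ?Q. Y \<oplus>\<^bsub>?Q\<^esub> X = \<zero>\<^bsub>?Q\<^esub>"
        using x carr M.a_inv_closed by blast
    next
      show "\<zero>\<^bsub>?Q\<^esub> \<in> carrier ?Q" using carr zero by blast
    next
      fix X Y assume "X \<in> carrier ?Q" "Y \<in> carrier ?Q"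
      then obtain x y where "x \<in> carrier M" "X = N +>\<^bsub>M\<^esub> x" "y \<in> carrier M" "Y = N +>\<^bsub>M\<^esub> y"
        using carr by metis
      thus "X \<oplus>\<^bsub>?Q\<^esub> Y = Y \<oplus>\<^bsub>?Q\<^esub> X" by (simp add: addc M.a_comm)
    qed (auto simp: carr addc zero M.a_assoc)
  qed (auto simp: carr quot_module_smult_coset[OF N] addc smult_l_distr smult_r_distr smult_assoc1)
qed

lemma (in module) torsion_part_submodule:
  assumes I: "ideal I R"
  shows "submodule (torsion_part R I M) R M"
proof -
  let ?P = "\<lambda>n::nat. I [^]\<^bsub>ideals_set R\<^esub> n"
  have powSuc: "?P (Suc n) = ideal_prod R (?P n) I" for n
    by (simp add: nat_pow_def ideals_set_def)
  have idl: "ideal (?P n) R" for n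
  proof (induction n)
    case 0 thus ?case by (simp add: nat_pow_def ideals_set_def R.oneideal)
  next
    case (Suc n) thus ?case using R.ideal_prod_is_ideal[OF Suc I] by (simp only: powSuc)
  qed
  have dec: "?P (n + k) \<subseteq> ?P n" for n k
  proof (induction k)
    case (Suc k)
    have "?P (n + Suc k) \<subseteq> ?P (n + k)"
      using R.ideal_prod_inter[OF idl I, of "n + k"] by (simp only: powSuc add_Suc_right) blast
    thus ?case using Suc by blast
  qed simp
  show ?thesis
  proof (rule submoduleI)
    fix x y assume "x \<in> torsion_part R I M" "y \<in> torsion_part R I M"
    then obtain n k where xy: "x \<in> carrier M" "y \<in> carrier M"
      "\<forall>r\<in>?P n. r \<odot>\<^bsub>M\<^esub> x = \<zero>\<^bsub>M\<^esub>" "\<forall>r\<in>?P k. r \<odot>\<^bsub>M\<^esub> y = \<zero>\<^bsub>M\<^esub>"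
      by (auto simp: torsion_part_def)
    have "r \<odot>\<^bsub>M\<^esub> (x \<oplus>\<^bsub>M\<^esub> y) = \<zero>\<^bsub>M\<^esub>" if "r \<in> ?P (n + k)" for r
      using that dec[of n k] dec[of k n] xy ideal.Icarr[OF idl that]
      by (auto simp: smult_r_distr add.commute subset_iff)
    thus "x \<oplus>\<^bsub>M\<^esub> y \<in> torsion_part R I M" using xy by (auto simp: torsion_part_def)
  next
    fix x assume "x \<in> torsion_part R I M"
    then obtain n where x: "x \<in> carrier M" "\<forall>r\<in>?P n. r \<odot>\<^bsub>M\<^esub> x = \<zero>\<^bsub>M\<^esub>"
      by (auto simp: torsion_part_def)
    have a: "a \<odot>\<^bsub>M\<^esub> x \<in> torsion_part R I M" if "a \<in> carrier R" for a
    proof -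
      have "r \<odot>\<^bsub>M\<^esub> (a \<odot>\<^bsub>M\<^esub> x) = \<zero>\<^bsub>M\<^esub>" if "r \<in> ?P n" for r
        using x ideal.I_r_closed[OF idl that \<open>a \<in> carrier R\<close>] ideal.Icarr[OF idl that]
        by (simp add: \<open>a \<in> carrier R\<close> flip: smult_assoc1)
      thus ?thesis using x that by (auto simp: torsion_part_def)
    qed
    show "a \<odot>\<^bsub>M\<^esub> x \<in> torsion_part R I M" if "a \<in> carrier R" for a by (rule a[OF that])
    show "\<ominus>\<^bsub>M\<^esub> x \<in> torsion_part R I M"
      using a[of "\<ominus>\<^bsub>R\<^esub> \<one>\<^bsub>R\<^esub>"] x by (simp add: smult_l_minus)
  next
    have "\<forall>r\<in>?P 0. r \<odot>\<^bsub>M\<^esub> \<zero>\<^bsub>M\<^esub> = \<zero>\<^bsub>M\<^esub>"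
      using ideal.Icarr[OF idl[of 0]] smult_r_null by blast
    thus "\<zero>\<^bsub>M\<^esub> \<in> torsion_part R I M" unfolding torsion_part_def by blast
  qed (auto simp: torsion_part_def)
qed

end

theory Submission
  imports Defs
begin

text \<open>Write \<open>G\<close> for the \<open>\<aa>\<close>-torsion of \<open>M\<close>.  Away from \<open>\<aa>\<close> the quotient \<open>M / G\<close> looks like \<open>M\<close>: at
  a prime \<open>p\<close> not containing \<open>\<aa>\<close> some element of \<open>\<aa>\<close> is a unit, so torsion vanishes in the
  localization, and (weakly) associated primes of \<open>M\<close> outside \<open>Var(\<aa>)\<close> survive with the same
  witness \<open>x\<close>.

  For the converse let \<open>p = (0 : x + G)\<close> be of finite type.  Since \<open>p x \<subseteq> G\<close> is generated by finitely
  many torsion elements, a single power satisfies \<open>\<aa>\<^sup>n p x = 0\<close>.  If \<open>\<aa> \<subseteq> p\<close>, then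
  \<open>\<aa>\<^sup>n\<^sup>+\<^sup>1 x = 0\<close> and \<open>x \<in> G\<close>, which is absurd; and for \<open>s \<in> \<aa>\<close> outside \<open>p\<close> the element \<open>s\<^sup>n x\<close> has
  annihilator \<open>p\<close>.  This is \<open>Ass_quot_finite_type\<close>, and it settles fairness.

  Weak fairness reduces to the same fact, because in any module a weakly associated prime of finite
  type is associated (\<open>weak_Ass_finite_type_imp_Ass\<close>): after localizing at \<open>p\<close>, the generators of \<open>p\<close>
  are nilpotent modulo the annihilator of \<open>x\<close>, hence kill some nonzero multiple of \<open>x\<close>.  The
  localization is never formed; \<open>y\<close> is nonzero in it exactly if \<open>elem_ann R M y \<subseteq> p\<close>.\<close>

section \<open>Prime ideals avoiding a multiplicative set\<close>

lemma (in cring) colon_ideal: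
  assumes Q: "ideal Q R" and a: "a \<in> carrier R"
  shows "ideal {r \<in> carrier R. r \<otimes> a \<in> Q} R"
proof (rule idealI[OF ring_axioms])
  show "subgroup {r \<in> carrier R. r \<otimes> a \<in> Q} (add_monoid R)"
  proof (rule add.subgroupI)
    have "\<zero> \<in> {r \<in> carrier R. r \<otimes> a \<in> Q}"
      using a additive_subgroup.zero_closed[OF ideal.axioms(1)[OF Q]] by simp
    thus "{r \<in> carrier R. r \<otimes> a \<in> Q} \<noteq> {}" by blast
  qed (use a in \<open>auto simp: l_distr l_minus additive_subgroup.a_closed[OF ideal.axioms(1)[OF Q]]
      additive_subgroup.a_inv_closed[OF ideal.axioms(1)[OF Q]]\<close>)
  fix r b assume r: "r \<in> {r \<in> carrier R. r \<otimes> a \<in> Q}" and b: "b \<in> carrier R"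
  show *: "b \<otimes> r \<in> {r \<in> carrier R. r \<otimes> a \<in> Q}"
    using r b a ideal.I_l_closed[OF Q, of "r \<otimes> a" b] by (simp add: m_assoc)
  show "r \<otimes> b \<in> {r \<in> carrier R. r \<otimes> a \<in> Q}"
    using * r b by (simp add: m_comm)
qed

lemma (in ring) ideal_Union_chain:
  assumes ne: "C \<noteq> {}" and C: "\<And>J. J \<in> C \<Longrightarrow> ideal J R"
    and chain: "\<And>J K. \<lbrakk> J \<in> C; K \<in> C \<rbrakk> \<Longrightarrow> J \<subseteq> K \<or> K \<subseteq> J"
  shows "ideal (\<Union>C) R"
proof (rule idealI[OF ring_axioms])
  show "subgroup (\<Union>C) (add_monoid R)"
  proof (rule add.subgroupI)
    show "\<Union>C \<subseteq> carrier R" using ideal.Icarr[OF C] by blast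
    show "\<Union>C \<noteq> {}" using ne additive_subgroup.zero_closed[OF ideal.axioms(1)[OF C]] by blast
    fix x assume "x \<in> \<Union>C"
    thus "\<ominus> x \<in> \<Union>C" using additive_subgroup.a_inv_closed[OF ideal.axioms(1)[OF C]] by blast
    fix y assume "y \<in> \<Union>C"
    with \<open>x \<in> \<Union>C\<close> obtain J where "J \<in> C" "x \<in> J" "y \<in> J" using chain by blast
    thus "x \<oplus> y \<in> \<Union>C" using additive_subgroup.a_closed[OF ideal.axioms(1)[OF C]] by blast
  qed
qed (use ideal.I_l_closed[OF C] ideal.I_r_closed[OF C] in blast)+

text \<open>An ideal \<open>Q\<close> that is maximal among the ideals avoiding \<open>W\<close> equals \<open>(Q : s)\<close> for every
  \<open>s \<in> W\<close>, because \<open>(Q : s)\<close> avoids \<open>W\<close> too.  So for \<open>a \<notin> Q\<close> an element \<open>s\<close> of \<open>W\<close> cannot lie in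
  \<open>(Q : a)\<close>, since this would put \<open>a\<close> into \<open>(Q : s) = Q\<close>; by maximality \<open>(Q : a) = Q\<close>, which is
  primality.\<close>

lemma (in cring) exists_prime_avoiding:
  assumes I: "ideal I R" and disj: "I \<inter> W = {}" and one: "\<one> \<in> W" and W: "W \<subseteq> carrier R"
    and mult: "\<And>s t. \<lbrakk> s \<in> W; t \<in> W \<rbrakk> \<Longrightarrow> s \<otimes> t \<in> W"
  shows "\<exists>Q. primeideal Q R \<and> I \<subseteq> Q \<and> Q \<inter> W = {}"
proof -
  let ?\<A> = "{J. ideal J R \<and> I \<subseteq> J \<and> J \<inter> W = {}}"
  have "\<exists>Q\<in>?\<A>. \<forall>J\<in>?\<A>. Q \<subseteq> J \<longrightarrow> J = Q"
  proof (rule subset_Zorn_nonempty)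
    show "?\<A> \<noteq> {}" using I disj by blast
    fix C assume C: "C \<noteq> {}" "subset.chain ?\<A> C"
    have "ideal (\<Union>C) R"
    proof (rule ideal_Union_chain[OF C(1)])
      show "ideal J R" if "J \<in> C" for J using C(2) that by (auto simp: pred_on.chain_def)
      show "J \<subseteq> K \<or> K \<subseteq> J" if "J \<in> C" "K \<in> C" for J K
        using C(2) that unfolding pred_on.chain_def by blast
    qed
    thus "\<Union>C \<in> ?\<A>" using C by (auto simp: pred_on.chain_def)
  qed
  then obtain Q where Q: "ideal Q R" "I \<subseteq> Q" "Q \<inter> W = {}"
    and max: "\<And>J. \<lbrakk> ideal J R; Q \<subseteq> J; J \<inter> W = {} \<rbrakk> \<Longrightarrow> J = Q" by auto
  have colon: "{r \<in> carrier R. r \<otimes> a \<in> Q} = Q"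
    if "a \<in> carrier R" "{r \<in> carrier R. r \<otimes> a \<in> Q} \<inter> W = {}" for a
    using max[OF colon_ideal[OF Q(1) that(1)] _ that(2)]
      ideal.I_r_closed[OF Q(1) _ that(1)] ideal.Icarr[OF Q(1)] by blast
  have colon_W: "r \<in> Q" if "s \<in> W" "r \<in> carrier R" "r \<otimes> s \<in> Q" for r s
  proof -
    have "{r \<in> carrier R. r \<otimes> s \<in> Q} \<inter> W = {}" using mult that(1) Q(3) by blast
    thus ?thesis using colon[of s] that W by blast
  qed
  have "primeideal Q R"
  proof (rule primeidealI[OF Q(1) is_cring])
    show "carrier R \<noteq> Q" using one Q(3) by blast
    fix a b assume ab: "a \<in> carrier R" "b \<in> carrier R" "a \<otimes> b \<in> Q"
    show "a \<in> Q \<or> b \<in> Q"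
    proof (rule ccontr)
      assume n: "\<not> (a \<in> Q \<or> b \<in> Q)"
      have "{r \<in> carrier R. r \<otimes> b \<in> Q} \<inter> W = {}"
        using colon_W ab(2) n by (auto simp: m_comm)
      thus False using colon[OF ab(2)] ab n by blast
    qed
  qed
  thus ?thesis using Q by blast
qed

lemma (in cring) nat_pow_notin_prime:
  assumes p: "primeideal p R" and s: "s \<in> carrier R" "s \<notin> p"
  shows "s [^] (n::nat) \<in> carrier R - p"
proof (induction n)
  case 0
  have "ideal p R" "p \<noteq> carrier R"
    using p primeideal.I_notcarr[OF p] by (auto simp: primeideal_def)
  thus ?case using ideal.one_imp_carrier by auto
next
  case (Suc n)
  thus ?case using primeideal.I_prime[OF p _ s(1)] s by auto
qed

text \<open>In the localization at \<open>p\<close>, the prime ideal \<open>p\<close> is the only one over \<open>I\<close>, so its elements are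
  nilpotent modulo \<open>I\<close>.\<close>

lemma (in cring) minimal_prime_over_power:
  assumes I: "ideal I R" and min: "minimal_prime_over R I p" and g: "g \<in> p"
  shows "\<exists>n::nat. \<exists>t \<in> carrier R - p. t \<otimes> g [^] n \<in> I"
proof (rule ccontr)
  assume neg: "\<not> ?thesis"
  have p: "primeideal p R" and minp: "\<And>q. \<lbrakk> primeideal q R; I \<subseteq> q; q \<subseteq> p \<rbrakk> \<Longrightarrow> q = p"
    using min by (auto simp: minimal_prime_over_def ideal_var_def)
  interpret p: primeideal p R by (rule p)
  have gc: "g \<in> carrier R" using g by (rule p.Icarr)
  have one: "\<one> \<in> carrier R - p" using p.one_imp_carrier p.I_notcarr by auto
  \<comment> \<open>Avoiding the elements \<open>t\<close> keeps a prime inside \<open>p\<close>, avoiding the powers of \<open>g\<close> keeps it away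
    from \<open>g\<close>; such a prime over \<open>I\<close> contradicts the minimality of \<open>p\<close>.\<close>
  define W where "W = {t \<otimes> g [^] n | t (n::nat). t \<in> carrier R - p}"
  have inW: "t \<otimes> g [^] (n::nat) \<in> W" if "t \<in> carrier R - p" for t n
    using that by (auto simp: W_def)
  have "\<exists>q. primeideal q R \<and> I \<subseteq> q \<and> q \<inter> W = {}"
  proof (rule exists_prime_avoiding[OF I])
    show "I \<inter> W = {}" using neg by (auto simp: W_def)
    show "\<one> \<in> W" using inW[OF one, of 0] by simp
    show "W \<subseteq> carrier R" using gc by (auto simp: W_def)
    fix u v assume "u \<in> W" "v \<in> W"
    then obtain s m t n where st: "s \<in> carrier R - p" "t \<in> carrier R - p"
      "u = s \<otimes> g [^] (m::nat)" "v = t \<otimes> g [^] (n::nat)" by (auto simp: W_def)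
    have "s \<otimes> t \<in> carrier R - p" using st p.I_prime by auto
    moreover have "u \<otimes> v = (s \<otimes> t) \<otimes> g [^] (m + n)"
      using st gc by (simp add: nat_pow_mult[symmetric] m_ac)
    ultimately show "u \<otimes> v \<in> W" using inW by simp
  qed
  then obtain q where q: "primeideal q R" "I \<subseteq> q" "q \<inter> W = {}" by blast
  interpret q: primeideal q R by (rule q(1))
  have "q \<subseteq> p"
  proof
    fix r assume r: "r \<in> q"
    show "r \<in> p" using inW[of r 0] r q.Icarr[OF r] q(3) by auto
  qed
  hence "q = p" by (rule minp[OF q(1,2)])
  thus False using inW[OF one, of 1] g gc q(3) by auto
qed


section \<open>Annihilators of elements and associated primes\<close>

context module
begin

lemma smult_left_commute:
  "\<lbrakk> a \<in> carrier R; b \<in> carrier R; x \<in> carrier M \<rbrakk> \<Longrightarrow> a \<odot>\<^bsub>M\<^esub> (b \<odot>\<^bsub>M\<^esub> x) = b \<odot>\<^bsub>M\<^esub> (a \<odot>\<^bsub>M\<^esub> x)"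
  by (metis smult_assoc1 R.m_comm)

lemma elem_ann_ideal:
  assumes x: "x \<in> carrier M"
  shows "ideal (elem_ann R M x) R"
proof (rule idealI[OF R.ring_axioms])
  show "subgroup (elem_ann R M x) (add_monoid R)"
  proof (rule R.add.subgroupI)
    show "elem_ann R M x \<noteq> {}" using x smult_l_null R.zero_closed by (fastforce simp: elem_ann_def)
  qed (use x in \<open>auto simp: elem_ann_def smult_l_distr smult_l_minus\<close>)
  fix r b assume r: "r \<in> elem_ann R M x" and b: "b \<in> carrier R"
  show *: "b \<otimes>\<^bsub>R\<^esub> r \<in> elem_ann R M x"
    using r b x by (simp add: elem_ann_def smult_assoc1)
  show "r \<otimes>\<^bsub>R\<^esub> b \<in> elem_ann R M x"
    using * r b R.m_comm[of r b] by (simp add: elem_ann_def)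
qed

lemma elem_ann_smult_subset_prime:
  assumes p: "primeideal p R" and t: "t \<in> carrier R - p" and y: "y \<in> carrier M"
    and ann: "elem_ann R M y \<subseteq> p"
  shows "elem_ann R M (t \<odot>\<^bsub>M\<^esub> y) \<subseteq> p"
proof
  fix r assume "r \<in> elem_ann R M (t \<odot>\<^bsub>M\<^esub> y)"
  hence r: "r \<in> carrier R" "r \<otimes>\<^bsub>R\<^esub> t \<in> elem_ann R M y"
    using t y by (auto simp: elem_ann_def smult_assoc1)
  thus "r \<in> p" using primeideal.I_prime[OF p r(1), of t] t ann by auto
qed

lemma Ass_subset_weak_Ass: "Ass R M \<subseteq> weak_Ass R M"
  by (auto simp: Ass_def weak_Ass_def minimal_prime_over_def ideal_var_def)

text \<open>Read in the localization at \<open>p\<close>, where \<open>elem_ann R M y \<subseteq> p\<close> says that \<open>y\<close> is nonzero: if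
  finitely many scalars act nilpotently on \<open>x \<noteq> 0\<close>, then one by one they can be made to annihilate a
  nonzero multiple of \<open>x\<close>, by going to the last nonzero power of the scalar.\<close>

lemma exists_multiple_annihilated:
  assumes p: "primeideal p R" and x: "x \<in> carrier M" and ann: "elem_ann R M x \<subseteq> p"
    and S: "finite S" "S \<subseteq> carrier R"
    and nil: "\<And>g. g \<in> S \<Longrightarrow> \<exists>n::nat. \<exists>t \<in> carrier R - p. (t \<otimes>\<^bsub>R\<^esub> g [^]\<^bsub>R\<^esub> n) \<odot>\<^bsub>M\<^esub> x = \<zero>\<^bsub>M\<^esub>"
  shows "\<exists>r \<in> carrier R. elem_ann R M (r \<odot>\<^bsub>M\<^esub> x) \<subseteq> p \<and> (\<forall>g \<in> S. g \<odot>\<^bsub>M\<^esub> (r \<odot>\<^bsub>M\<^esub> x) = \<zero>\<^bsub>M\<^esub>)"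
  using S nil
proof (induction S rule: finite_induct)
  case empty
  show ?case using x ann by (intro bexI[of _ "\<one>\<^bsub>R\<^esub>"]) auto
next
  case (insert g S)
  then obtain r where r: "r \<in> carrier R" "elem_ann R M (r \<odot>\<^bsub>M\<^esub> x) \<subseteq> p"
    "\<And>h. h \<in> S \<Longrightarrow> h \<odot>\<^bsub>M\<^esub> (r \<odot>\<^bsub>M\<^esub> x) = \<zero>\<^bsub>M\<^esub>" by auto
  have g: "g \<in> carrier R" and Sc: "S \<subseteq> carrier R" using insert.prems by auto
  let ?y = "r \<odot>\<^bsub>M\<^esub> x"
  let ?P = "\<lambda>k::nat. \<exists>u \<in> carrier R - p. (u \<otimes>\<^bsub>R\<^esub> g [^]\<^bsub>R\<^esub> k) \<odot>\<^bsub>M\<^esub> ?y = \<zero>\<^bsub>M\<^esub>"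
  have y: "?y \<in> carrier M" using r x by simp
  obtain n t where t: "t \<in> carrier R - p" "(t \<otimes>\<^bsub>R\<^esub> g [^]\<^bsub>R\<^esub> (n::nat)) \<odot>\<^bsub>M\<^esub> x = \<zero>\<^bsub>M\<^esub>"
    using insert.prems(2)[of g] by auto
  hence "(t \<otimes>\<^bsub>R\<^esub> g [^]\<^bsub>R\<^esub> n) \<odot>\<^bsub>M\<^esub> ?y = \<zero>\<^bsub>M\<^esub>"
    using r x g smult_left_commute[of "t \<otimes>\<^bsub>R\<^esub> g [^]\<^bsub>R\<^esub> n" r x] by simp
  hence "?P n" using t(1) by blast
  hence P: "?P (LEAST k. ?P k)" by (rule LeastI)
  have "\<not> ?P 0" using r(2) by (auto simp: elem_ann_def)
  then obtain j where j: "(LEAST k. ?P k) = Suc j" using P by (cases "LEAST k. ?P k") auto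
  hence notP: "\<not> ?P j" using not_less_Least[of j ?P] by simp
  obtain u where u: "u \<in> carrier R - p" "(u \<otimes>\<^bsub>R\<^esub> g [^]\<^bsub>R\<^esub> Suc j) \<odot>\<^bsub>M\<^esub> ?y = \<zero>\<^bsub>M\<^esub>" using P j by auto
  \<comment> \<open>At \<open>p\<close>, \<open>g\<^sup>j y\<close> is the last nonzero power; the factor \<open>u\<close> turns \<open>g\<^sup>j\<^sup>+\<^sup>1 y = 0\<close> at \<open>p\<close> into an
    equation in \<open>M\<close>.\<close>
  let ?s = "u \<otimes>\<^bsub>R\<^esub> g [^]\<^bsub>R\<^esub> j"
  have s: "?s \<in> carrier R" using u g by simp
  have eq: "(?s \<otimes>\<^bsub>R\<^esub> r) \<odot>\<^bsub>M\<^esub> x = ?s \<odot>\<^bsub>M\<^esub> ?y" using s r x by (simp add: smult_assoc1)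
  have "elem_ann R M (?s \<odot>\<^bsub>M\<^esub> ?y) \<subseteq> p"
  proof
    fix a assume "a \<in> elem_ann R M (?s \<odot>\<^bsub>M\<^esub> ?y)"
    hence a: "a \<in> carrier R" "a \<odot>\<^bsub>M\<^esub> (?s \<odot>\<^bsub>M\<^esub> ?y) = \<zero>\<^bsub>M\<^esub>" by (auto simp: elem_ann_def)
    hence "((a \<otimes>\<^bsub>R\<^esub> u) \<otimes>\<^bsub>R\<^esub> g [^]\<^bsub>R\<^esub> j) \<odot>\<^bsub>M\<^esub> ?y = \<zero>\<^bsub>M\<^esub>"
      using u g y s by (simp add: smult_assoc1)
    hence "a \<otimes>\<^bsub>R\<^esub> u \<in> p" using notP a u by blast
    thus "a \<in> p" using primeideal.I_prime[OF p a(1), of u] u by auto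
  qed
  moreover have "g \<odot>\<^bsub>M\<^esub> (?s \<odot>\<^bsub>M\<^esub> ?y) = \<zero>\<^bsub>M\<^esub>"
  proof -
    have "g \<odot>\<^bsub>M\<^esub> (?s \<odot>\<^bsub>M\<^esub> ?y) = (g \<otimes>\<^bsub>R\<^esub> ?s) \<odot>\<^bsub>M\<^esub> ?y" using g s y by (simp add: smult_assoc1)
    also have "g \<otimes>\<^bsub>R\<^esub> ?s = u \<otimes>\<^bsub>R\<^esub> g [^]\<^bsub>R\<^esub> Suc j" using g u by (simp add: m_ac)
    finally show ?thesis using u by simp
  qed
  moreover have "h \<odot>\<^bsub>M\<^esub> (?s \<odot>\<^bsub>M\<^esub> ?y) = \<zero>\<^bsub>M\<^esub>" if "h \<in> S" for h
    using that Sc s y r(3)[OF that] smult_left_commute[of h ?s ?y] by auto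
  ultimately show ?case using s r eq by (intro bexI[of _ "?s \<otimes>\<^bsub>R\<^esub> r"]) auto
qed

text \<open>The multiple of \<open>x\<close> annihilated by the generators of \<open>p\<close> is still nonzero at \<open>p\<close>, so its
  annihilator is squeezed between \<open>p\<close> and \<open>p\<close>.\<close>

lemma weak_Ass_finite_type_imp_Ass:
  assumes p: "p \<in> weak_Ass R M" and ft: "finite_type_ideal R p"
  shows "p \<in> Ass R M"
proof -
  obtain x where pp: "primeideal p R" and x: "x \<in> carrier M"
    and min: "minimal_prime_over R (elem_ann R M x) p"
    using p by (auto simp: weak_Ass_def)
  obtain S where S: "S \<subseteq> carrier R" "finite S" "p = Idl S"
    using ft by (auto simp: finite_type_ideal_def)
  have Sp: "S \<subseteq> p" using R.genideal_self S by blast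
  have "\<exists>n::nat. \<exists>t \<in> carrier R - p. (t \<otimes>\<^bsub>R\<^esub> g [^]\<^bsub>R\<^esub> n) \<odot>\<^bsub>M\<^esub> x = \<zero>\<^bsub>M\<^esub>" if "g \<in> S" for g
    using R.minimal_prime_over_power[OF elem_ann_ideal[OF x] min, of g] that Sp
    by (auto simp: elem_ann_def)
  moreover have "elem_ann R M x \<subseteq> p"
    using min by (auto simp: minimal_prime_over_def ideal_var_def)
  ultimately obtain r where r: "r \<in> carrier R" "elem_ann R M (r \<odot>\<^bsub>M\<^esub> x) \<subseteq> p"
    "\<And>g. g \<in> S \<Longrightarrow> g \<odot>\<^bsub>M\<^esub> (r \<odot>\<^bsub>M\<^esub> x) = \<zero>\<^bsub>M\<^esub>"
    using exists_multiple_annihilated[OF pp x _ S(2,1)] by blast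
  have y: "r \<odot>\<^bsub>M\<^esub> x \<in> carrier M" using r x by simp
  have "p \<subseteq> elem_ann R M (r \<odot>\<^bsub>M\<^esub> x)"
    unfolding S(3) using r S(1) by (intro R.genideal_minimal[OF elem_ann_ideal[OF y]])
      (auto simp: elem_ann_def)
  thus ?thesis using r y pp by (auto simp: Ass_def)
qed


section \<open>Torsion and the quotient by it\<close>

lemma ideals_set_pow_Suc:
  "I [^]\<^bsub>ideals_set R\<^esub> Suc n = ideal_prod R (I [^]\<^bsub>ideals_set R\<^esub> n) I"
  by (simp add: nat_pow_def ideals_set_def)

lemma ideals_set_pow_ideal:
  assumes I: "ideal I R"
  shows "ideal (I [^]\<^bsub>ideals_set R\<^esub> (n::nat)) R"
proof (induction n)
  case 0
  thus ?case by (simp add: nat_pow_def ideals_set_def R.oneideal)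
next
  case (Suc n)
  thus ?case using R.ideal_prod_is_ideal[OF Suc I] by (simp only: ideals_set_pow_Suc)
qed

lemma ideals_set_pow_decreasing:
  assumes I: "ideal I R" and "m \<le> n"
  shows "I [^]\<^bsub>ideals_set R\<^esub> (n::nat) \<subseteq> I [^]\<^bsub>ideals_set R\<^esub> m"
  using \<open>m \<le> n\<close>
proof (induction n rule: dec_induct)
  case (step n)
  thus ?case using R.ideal_prod_inter[OF ideals_set_pow_ideal[OF I] I, of n]
    by (simp only: ideals_set_pow_Suc) blast
qed simp

lemma pow_in_ideals_set_pow:
  assumes I: "ideal I R" and s: "s \<in> I"
  shows "s [^]\<^bsub>R\<^esub> n \<in> I [^]\<^bsub>ideals_set R\<^esub> (n::nat)"
proof (induction n)
  case 0
  thus ?case by (simp add: nat_pow_def ideals_set_def)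
next
  case (Suc n)
  thus ?case using s by (simp only: ideals_set_pow_Suc R.nat_pow_Suc ideal_prod.prod)
qed

lemma mem_torsion_part_iff:
  assumes I: "ideal I R"
  shows "x \<in> torsion_part R I M \<longleftrightarrow>
    x \<in> carrier M \<and> (\<exists>n::nat. I [^]\<^bsub>ideals_set R\<^esub> n \<subseteq> elem_ann R M x)"
  using ideal.Icarr[OF ideals_set_pow_ideal[OF I]]
  by (auto simp: torsion_part_def elem_ann_def subset_iff)

lemma pow_smult_eq_zero_of_torsion:
  assumes I: "ideal I R" and s: "s \<in> I" and x: "x \<in> torsion_part R I M"
  shows "\<exists>n::nat. s [^]\<^bsub>R\<^esub> n \<odot>\<^bsub>M\<^esub> x = \<zero>\<^bsub>M\<^esub>"
  using x pow_in_ideals_set_pow[OF I s] by (auto simp: torsion_part_def)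

text \<open>Finitely many torsion elements are annihilated by a common power of \<open>I\<close>, and the scalars
  \<open>r\<close> for which that power annihilates \<open>r x\<close> form an ideal.\<close>

lemma finite_type_torsion_bound:
  assumes I: "ideal I R" and p: "finite_type_ideal R p" and x: "x \<in> carrier M"
    and tors: "\<And>g. g \<in> p \<Longrightarrow> g \<odot>\<^bsub>M\<^esub> x \<in> torsion_part R I M"
  shows "\<exists>n::nat. \<forall>r \<in> I [^]\<^bsub>ideals_set R\<^esub> n. p \<subseteq> elem_ann R M (r \<odot>\<^bsub>M\<^esub> x)"
proof -
  let ?P = "\<lambda>n::nat. I [^]\<^bsub>ideals_set R\<^esub> n"
  obtain S where S: "S \<subseteq> carrier R" "finite S" "p = Idl S"
    using p by (auto simp: finite_type_ideal_def)
  have "\<forall>g \<in> S. \<exists>n. ?P n \<subseteq> elem_ann R M (g \<odot>\<^bsub>M\<^esub> x)"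
    using tors R.genideal_self[OF S(1)] S(3) by (auto simp: mem_torsion_part_iff[OF I])
  then obtain N where N: "\<And>g. g \<in> S \<Longrightarrow> ?P (N g) \<subseteq> elem_ann R M (g \<odot>\<^bsub>M\<^esub> x)" by metis
  have "p \<subseteq> elem_ann R M (r \<odot>\<^bsub>M\<^esub> x)" if r: "r \<in> ?P (sum N S)" for r
  proof -
    have rc: "r \<in> carrier R" by (rule ideal.Icarr[OF ideals_set_pow_ideal[OF I] r])
    have "S \<subseteq> elem_ann R M (r \<odot>\<^bsub>M\<^esub> x)"
    proof
      fix g assume g: "g \<in> S"
      have "r \<in> ?P (N g)"
        using ideals_set_pow_decreasing[OF I member_le_sum[OF g, of N]] S(2) r by auto
      hence "r \<odot>\<^bsub>M\<^esub> (g \<odot>\<^bsub>M\<^esub> x) = \<zero>\<^bsub>M\<^esub>" using N[OF g] by (auto simp: elem_ann_def)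
      thus "g \<in> elem_ann R M (r \<odot>\<^bsub>M\<^esub> x)"
        using g S(1) rc x smult_left_commute[of r g x] by (auto simp: elem_ann_def)
    qed
    thus ?thesis unfolding S(3) using rc x by (intro R.genideal_minimal elem_ann_ideal) auto
  qed
  thus ?thesis by blast
qed

lemma elem_ann_quot_module:
  assumes N: "submodule N R M" and x: "x \<in> carrier M"
  shows "elem_ann R (quot_module M N) (N +>\<^bsub>M\<^esub> x) = {r \<in> carrier R. r \<odot>\<^bsub>M\<^esub> x \<in> N}"
proof -
  have sg: "subgroup N (add_monoid M)" using N by (simp add: submodule_def)
  have as: "abelian_subgroup N M"
    by (rule abelian_subgroupI3[OF additive_subgroup.intro[OF sg] M.abelian_group_axioms])
  have "N +>\<^bsub>M\<^esub> y = N \<longleftrightarrow> y \<in> N" if "y \<in> carrier M" for y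
    using that abelian_subgroup.a_rcos_const[OF as] abelian_subgroup.a_rcos_self[OF as] by metis
  moreover have "\<zero>\<^bsub>quot_module M N\<^esub> = N" by (simp add: quot_module_def)
  ultimately have "r \<odot>\<^bsub>quot_module M N\<^esub> (N +>\<^bsub>M\<^esub> x) = \<zero>\<^bsub>quot_module M N\<^esub> \<longleftrightarrow> r \<odot>\<^bsub>M\<^esub> x \<in> N"
    if "r \<in> carrier R" for r
    using that x by (simp add: quot_module_smult_coset[OF N])
  thus ?thesis by (auto simp: elem_ann_def)
qed

lemma carrier_quot_module:
  "carrier (quot_module M N) = {N +>\<^bsub>M\<^esub> x | x. x \<in> carrier M}"
  by (auto simp: quot_module_def A_RCOSETS_def')

text \<open>If \<open>r x\<close> is torsion, then a power of any \<open>s \<in> I\<close> outside \<open>p\<close> kills it; as \<open>s\<close> acts like a unit at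
  \<open>p\<close>, already \<open>r x\<close> is zero there, which forces \<open>r \<in> p\<close>.\<close>

lemma elem_ann_quot_torsion_subset:
  assumes I: "ideal I R" and p: "primeideal p R" and Ip: "\<not> I \<subseteq> p" and x: "x \<in> carrier M"
    and ann: "elem_ann R M x \<subseteq> p"
  shows "elem_ann R (quot_module M (torsion_part R I M)) (torsion_part R I M +>\<^bsub>M\<^esub> x) \<subseteq> p"
proof
  interpret p: primeideal p R by (rule p)
  obtain s where s: "s \<in> I" "s \<notin> p" using Ip by blast
  have sc: "s \<in> carrier R" by (rule ideal.Icarr[OF I s(1)])
  have pow: "s [^]\<^bsub>R\<^esub> (n::nat) \<in> carrier R - p" for n
    by (rule R.nat_pow_notin_prime[OF p sc s(2)])
  fix r assume "r \<in> elem_ann R (quot_module M (torsion_part R I M)) (torsion_part R I M +>\<^bsub>M\<^esub> x)"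
  hence r: "r \<in> carrier R" "r \<odot>\<^bsub>M\<^esub> x \<in> torsion_part R I M"
    by (auto simp: elem_ann_quot_module[OF torsion_part_submodule[OF I] x])
  obtain n where "s [^]\<^bsub>R\<^esub> (n::nat) \<odot>\<^bsub>M\<^esub> (r \<odot>\<^bsub>M\<^esub> x) = \<zero>\<^bsub>M\<^esub>"
    using pow_smult_eq_zero_of_torsion[OF I s(1) r(2)] by blast
  hence "r \<in> elem_ann R M (s [^]\<^bsub>R\<^esub> n \<odot>\<^bsub>M\<^esub> x)"
    using r sc x smult_left_commute[of "s [^]\<^bsub>R\<^esub> n" r x] by (auto simp: elem_ann_def)
  thus "r \<in> p" using elem_ann_smult_subset_prime[OF p pow x ann] by blast
qed

lemma elem_ann_subset_quot_torsion:
  assumes I: "ideal I R" and x: "x \<in> carrier M"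
  shows "elem_ann R M x
    \<subseteq> elem_ann R (quot_module M (torsion_part R I M)) (torsion_part R I M +>\<^bsub>M\<^esub> x)"
proof -
  have "\<zero>\<^bsub>M\<^esub> \<in> torsion_part R I M"
    using torsion_part_submodule[OF I] subgroup.one_closed by (force simp: submodule_def)
  thus ?thesis
    by (auto simp: elem_ann_quot_module[OF torsion_part_submodule[OF I] x]) (auto simp: elem_ann_def)
qed

lemma Ass_minus_var_subset_quot:
  assumes I: "ideal I R"
  shows "Ass R M - ideal_var R I \<subseteq> Ass R (quot_module M (torsion_part R I M))"
proof
  fix p assume "p \<in> Ass R M - ideal_var R I"
  then obtain x where p: "primeideal p R" "\<not> I \<subseteq> p" and x: "x \<in> carrier M" "p = elem_ann R M x"
    by (auto simp: Ass_def ideal_var_def)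
  have "p = elem_ann R (quot_module M (torsion_part R I M)) (torsion_part R I M +>\<^bsub>M\<^esub> x)"
    using elem_ann_quot_torsion_subset[OF I p x(1)] elem_ann_subset_quot_torsion[OF I x(1)] x(2)
    by blast
  thus "p \<in> Ass R (quot_module M (torsion_part R I M))"
    using p x(1) unfolding Ass_def carrier_quot_module by blast
qed

lemma weak_Ass_minus_var_subset_quot:
  assumes I: "ideal I R"
  shows "weak_Ass R M - ideal_var R I \<subseteq> weak_Ass R (quot_module M (torsion_part R I M))"
proof
  fix p assume "p \<in> weak_Ass R M - ideal_var R I"
  then obtain x where p: "primeideal p R" "\<not> I \<subseteq> p" and x: "x \<in> carrier M"
    and min: "minimal_prime_over R (elem_ann R M x) p"
    by (auto simp: weak_Ass_def ideal_var_def)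
  let ?J = "elem_ann R (quot_module M (torsion_part R I M)) (torsion_part R I M +>\<^bsub>M\<^esub> x)"
  have "elem_ann R M x \<subseteq> p" using min by (auto simp: minimal_prime_over_def ideal_var_def)
  hence "?J \<subseteq> p" by (rule elem_ann_quot_torsion_subset[OF I p x])
  moreover have "ideal_var R ?J \<subseteq> ideal_var R (elem_ann R M x)"
    using elem_ann_subset_quot_torsion[OF I x] by (auto simp: ideal_var_def)
  ultimately have "minimal_prime_over R ?J p"
    using min p(1) by (auto simp: minimal_prime_over_def ideal_var_def)
  thus "p \<in> weak_Ass R (quot_module M (torsion_part R I M))"
    using p(1) x unfolding weak_Ass_def carrier_quot_module by blast
qed

text \<open>The bound \<open>n\<close> with \<open>I\<^sup>n p x = 0\<close> does two things: it excludes \<open>I \<subseteq> p\<close>, where \<open>I\<^sup>n\<^sup>+\<^sup>1 x = 0\<close> would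
  make \<open>x\<close> torsion, and for \<open>s \<in> I\<close> outside \<open>p\<close> it makes \<open>p\<close> annihilate \<open>s\<^sup>n x\<close>.\<close>

lemma Ass_quot_finite_type:
  assumes I: "ideal I R" and p: "p \<in> Ass R (quot_module M (torsion_part R I M))"
    and ft: "finite_type_ideal R p"
  shows "p \<in> Ass R M - ideal_var R I"
proof -
  let ?G = "torsion_part R I M"
  obtain x where pp: "primeideal p R" and x: "x \<in> carrier M"
    and peq: "p = {r \<in> carrier R. r \<odot>\<^bsub>M\<^esub> x \<in> ?G}"
    using p by (auto simp: Ass_def carrier_quot_module
        elem_ann_quot_module[OF torsion_part_submodule[OF I]])
  interpret p: primeideal p R by (rule pp)
  have one: "\<one>\<^bsub>R\<^esub> \<notin> p" using p.one_imp_carrier p.I_notcarr by auto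
  obtain n where n: "\<And>r. r \<in> I [^]\<^bsub>ideals_set R\<^esub> (n::nat) \<Longrightarrow> p \<subseteq> elem_ann R M (r \<odot>\<^bsub>M\<^esub> x)"
    using finite_type_torsion_bound[OF I ft x] peq by blast
  have nIp: "\<not> I \<subseteq> p"
  proof
    assume Ip: "I \<subseteq> p"
    have "a \<in> elem_ann R M x" if "a \<in> I [^]\<^bsub>ideals_set R\<^esub> Suc n" for a
      using that unfolding ideals_set_pow_Suc
    proof (induction a rule: ideal_prod.induct)
      case (prod i j)
      have "i \<in> carrier R" "j \<in> carrier R"
        using ideal.Icarr[OF ideals_set_pow_ideal[OF I] prod(1)] ideal.Icarr[OF I prod(2)] by auto
      thus ?case using n[OF prod(1)] Ip prod(2) x smult_left_commute[of j i x]
        by (auto simp: elem_ann_def smult_assoc1)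
    next
      case (sum a b)
      interpret ann: ideal "elem_ann R M x" R by (rule elem_ann_ideal[OF x])
      show ?case using sum by simp
    qed
    hence "I [^]\<^bsub>ideals_set R\<^esub> Suc n \<subseteq> elem_ann R M x" by (rule subsetI)
    hence "x \<in> ?G" using x unfolding mem_torsion_part_iff[OF I] by blast
    hence "\<one>\<^bsub>R\<^esub> \<in> {r \<in> carrier R. r \<odot>\<^bsub>M\<^esub> x \<in> ?G}" using x by simp
    thus False using one peq by blast
  qed
  then obtain s where s: "s \<in> I" "s \<notin> p" by blast
  have sc: "s \<in> carrier R" by (rule ideal.Icarr[OF I s(1)])
  have pow: "s [^]\<^bsub>R\<^esub> n \<in> carrier R - p"
    by (rule R.nat_pow_notin_prime[OF pp sc s(2)])
  have "elem_ann R M x \<subseteq> p"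
    using elem_ann_subset_quot_torsion[OF I x]
    unfolding elem_ann_quot_module[OF torsion_part_submodule[OF I] x] peq[symmetric] .
  hence "elem_ann R M (s [^]\<^bsub>R\<^esub> n \<odot>\<^bsub>M\<^esub> x) = p"
    using elem_ann_smult_subset_prime[OF pp pow x] n[OF pow_in_ideals_set_pow[OF I s(1)]] by blast
  moreover have "s [^]\<^bsub>R\<^esub> n \<odot>\<^bsub>M\<^esub> x \<in> carrier M" using pow x by simp
  ultimately show ?thesis using pp nIp unfolding Ass_def ideal_var_def by blast
qed

end

theorem mainTheorem11:
  fixes R :: "('a, 'm) ring_scheme"
    and M :: "('a, 'b, 'n) module_scheme"
    and \<aa> :: "'a set"
  assumes "module R M"
    and "finite_type_ideal R \<aa>"
  shows "((\<forall>p \<in> Ass R (quot_module M (torsion_part R \<aa> M)). finite_type_ideal R p)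
            \<longrightarrow> fair_module R \<aa> M)
       \<and> ((\<forall>p \<in> weak_Ass R (quot_module M (torsion_part R \<aa> M)). finite_type_ideal R p)
            \<longrightarrow> weakly_fair_module R \<aa> M)"
proof -
  interpret module R M by (rule assms(1))
  have I: "ideal \<aa> R" using assms(2) by (simp add: finite_type_ideal_def)
  let ?Q = "quot_module M (torsion_part R \<aa> M)"
  interpret Q: module R ?Q by (rule quot_module_is_module[OF torsion_part_submodule[OF I]])
  have "fair_module R \<aa> M" if "\<forall>p \<in> Ass R ?Q. finite_type_ideal R p"
    using that Ass_minus_var_subset_quot[OF I] Ass_quot_finite_type[OF I]
    unfolding fair_module_def by blast
  moreover have "weakly_fair_module R \<aa> M" if "\<forall>p \<in> weak_Ass R ?Q. finite_type_ideal R p"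
  proof -
    have "p \<in> weak_Ass R M - ideal_var R \<aa>" if "p \<in> weak_Ass R ?Q" for p
      using that \<open>\<forall>p \<in> weak_Ass R ?Q. finite_type_ideal R p\<close> Q.weak_Ass_finite_type_imp_Ass
        Ass_quot_finite_type[OF I] Ass_subset_weak_Ass by blast
    thus ?thesis using weak_Ass_minus_var_subset_quot[OF I]
      unfolding weakly_fair_module_def by blast
  qed
  ultimately show ?thesis by blast
qed

end
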